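(* Let $\alpha\in[0,1)$. The Price of Anarchy of pure Platform Equilibrium when the platform sets transaction fee $\alpha$ is at most $\frac{2-\alpha}{1-\alpha}$: for every market $(S,B,\mathbf v,G)$ and every pure Platform Equilibrium $P\subseteq S$ at fee $\alpha$, $$W^\star(S,B,\mathbf v)\le\frac{2-\alpha}{1-\alpha}\,W(S,B,G(P)).$$
   Context: A market $(S,B,\mathbf v,G)$ consists of a finite set $B=\{1,\dots,n\}$ of buyers, a finite set $S=\{1,\dots,m\}$ of sellers (each owning one item), values $v_{ij}\ge 0$ of buyer $i$ for seller $j$'s item (each buyer is unit-demand), and a bipartite graph $G$ between $B$ and $S$ whose edges are the pairs that can transact directly. $W(S',B',G)$ denotes the maximum of $\sum v_{ij}$ over matchings between $B'\subseteq B$ and $S'\subseteq S$ that use only edges of $G$. The optimal welfare $W^\star(S,B,\mathbf v)$ is $W(S,B,K)$ where $K$ is the complete bipartite graph between $B$ and $S$. For a set $P\subseteq S$ of sellers joining the platform, $G(P)$ is the graph obtained from $G$ by adding all edges between $P$ and $B$. The market then clears at the maximum competitive (Walrasian) equilibrium prices with respect to $G(P)$, which equal $p_j(P)=W(S,B,G(P))-W(S\setminus\{j\},B,G(P))$, and the resulting social welfare is $W(S,B,G(P))$. At fee $\alpha$, a seller $j\in P$ has utility $(1-\alpha)p_j(P)$ and a seller $j\notin P$ has utility $p_j(P)$. A set $P\subseteq S$ is a pure Platform Equilibrium at fee $\alpha$ if for all $j\in P$: $(1-\alpha)p_j(P)\ge p_j(P\setminus\{j\})$, and for all $j\notin P$: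 $p_j(P)\ge(1-\alpha)p_j(P\cup\{j\})$. *)

theory Defs
  imports Complex_Main
begin

definition market :: "'s set \<Rightarrow> 'b set \<Rightarrow> ('b \<Rightarrow> 's \<Rightarrow> real) \<Rightarrow> ('b \<times> 's) set \<Rightarrow> bool" where
  "market S B v G \<longleftrightarrow>
     finite S \<and> finite B \<and> (\<forall>i\<in>B. \<forall>j\<in>S. 0 \<le> v i j) \<and> G \<subseteq> B \<times> S"

definition matching :: "'s set \<Rightarrow> 'b set \<Rightarrow> ('b \<times> 's) set \<Rightarrow> ('b \<times> 's) set \<Rightarrow> bool" where
  "matching S B G M \<longleftrightarrow> M \<subseteq> G \<inter> (B \<times> S) \<and> inj_on fst M \<and> inj_on snd M"

definition value_of :: "('b \<Rightarrow> 's \<Rightarrow> real) \<Rightarrow> ('b \<times> 's) set \<Rightarrow> real" where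
  "value_of v M = (\<Sum>(i, j)\<in>M. v i j)"

definition welfare :: "('b \<Rightarrow> 's \<Rightarrow> real) \<Rightarrow> 's set \<Rightarrow> 'b set \<Rightarrow> ('b \<times> 's) set \<Rightarrow> real" where
  "welfare v S B G = Max (value_of v ` {M. matching S B G M})"

definition optimal_welfare :: "('b \<Rightarrow> 's \<Rightarrow> real) \<Rightarrow> 's set \<Rightarrow> 'b set \<Rightarrow> real" where
  "optimal_welfare v S B = welfare v S B (B \<times> S)"

definition join_platform :: "'b set \<Rightarrow> ('b \<times> 's) set \<Rightarrow> 's set \<Rightarrow> ('b \<times> 's) set" where
  "join_platform B G P = G \<union> B \<times> P"

text \<open>In a matching the sum has at most one term, and it is 0 for an unmatched buyer.\<close>

definition buyer_utility ::
    "('b \<Rightarrow> 's \<Rightarrow> real) \<Rightarrow> ('b \<times> 's) set \<Rightarrow> ('s \<Rightarrow> real) \<Rightarrow> 'b \<Rightarrow> real" where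
  "buyer_utility v M p i = (\<Sum>j | (i, j) \<in> M. v i j - p j)"

text \<open>Every buyer receives a most preferred option among nothing and the items she is
  connected to in \<open>G\<close>, and unsold items have price 0.\<close>

definition competitive_equilibrium ::
    "('b \<Rightarrow> 's \<Rightarrow> real) \<Rightarrow> 's set \<Rightarrow> 'b set \<Rightarrow> ('b \<times> 's) set \<Rightarrow>
     ('b \<times> 's) set \<Rightarrow> ('s \<Rightarrow> real) \<Rightarrow> bool" where
  "competitive_equilibrium v S B G M p \<longleftrightarrow>
     matching S B G M \<and>
     (\<forall>j\<in>S. 0 \<le> p j) \<and>
     (\<forall>i\<in>B. 0 \<le> buyer_utility v M p i \<and>
        (\<forall>j\<in>S. (i, j) \<in> G \<longrightarrow> v i j - p j \<le> buyer_utility v M p i)) \<and>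
     (\<forall>j\<in>S. j \<notin> snd ` M \<longrightarrow> p j = 0)"

definition competitive_prices ::
    "('b \<Rightarrow> 's \<Rightarrow> real) \<Rightarrow> 's set \<Rightarrow> 'b set \<Rightarrow> ('b \<times> 's) set \<Rightarrow> ('s \<Rightarrow> real) \<Rightarrow> bool" where
  "competitive_prices v S B G p \<longleftrightarrow> (\<exists>M. competitive_equilibrium v S B G M p)"

definition maximum_competitive_prices ::
    "('b \<Rightarrow> 's \<Rightarrow> real) \<Rightarrow> 's set \<Rightarrow> 'b set \<Rightarrow> ('b \<times> 's) set \<Rightarrow> ('s \<Rightarrow> real) \<Rightarrow> bool" where
  "maximum_competitive_prices v S B G p \<longleftrightarrow>
     competitive_prices v S B G p \<and>
     (\<forall>q. competitive_prices v S B G q \<longrightarrow> (\<forall>j\<in>S. q j \<le> p j))"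

text \<open>The maximum competitive prices exist and are unique on \<open>S\<close>; outside \<open>S\<close> the values are
  irrelevant. See \<open>clearing_price_maximum\<close> and \<open>clearing_price_eq\<close> below.\<close>

definition clearing_price ::
    "('b \<Rightarrow> 's \<Rightarrow> real) \<Rightarrow> 's set \<Rightarrow> 'b set \<Rightarrow> ('b \<times> 's) set \<Rightarrow> 's \<Rightarrow> real" where
  "clearing_price v S B G = (SOME p. maximum_competitive_prices v S B G p)"

definition seller_utility ::
    "real \<Rightarrow> ('b \<Rightarrow> 's \<Rightarrow> real) \<Rightarrow> 's set \<Rightarrow> 'b set \<Rightarrow> ('b \<times> 's) set \<Rightarrow> 's set \<Rightarrow> 's \<Rightarrow> real" where
  "seller_utility \<alpha> v S B G P j =
     (if j \<in> P then (1 - \<alpha>) * clearing_price v S B (join_platform B G P) j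
      else clearing_price v S B (join_platform B G P) j)"

definition platform_equilibrium ::
    "real \<Rightarrow> ('b \<Rightarrow> 's \<Rightarrow> real) \<Rightarrow> 's set \<Rightarrow> 'b set \<Rightarrow> ('b \<times> 's) set \<Rightarrow> 's set \<Rightarrow> bool" where
  "platform_equilibrium \<alpha> v S B G P \<longleftrightarrow>
     P \<subseteq> S \<and>
     (\<forall>j\<in>P. seller_utility \<alpha> v S B G P j \<ge> seller_utility \<alpha> v S B G (P - {j}) j) \<and>
     (\<forall>j\<in>S - P. seller_utility \<alpha> v S B G P j \<ge> seller_utility \<alpha> v S B G (P \<union> {j}) j)"


subsection \<open>The maximum competitive prices are the marginal welfare contributions\<close>

lemma matching_finite: "finite S \<Longrightarrow> finite B \<Longrightarrow> matching S B G M \<Longrightarrow> finite M"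
  unfolding matching_def by (meson Int_lower2 finite_SigmaI finite_subset)

lemma finite_matchings: "finite S \<Longrightarrow> finite B \<Longrightarrow> finite {M. matching S B G M}"
  by (rule finite_subset[of _ "Pow (B \<times> S)"]) (auto simp: matching_def)

lemma value_le_welfare:
  "finite S \<Longrightarrow> finite B \<Longrightarrow> matching S B G M \<Longrightarrow> value_of v M \<le> welfare v S B G"
  unfolding welfare_def by (rule Max_ge) (auto intro: finite_matchings)

lemma welfare_attained:
  assumes "finite S" "finite B"
  obtains M where "matching S B G M" "value_of v M = welfare v S B G"
proof -
  have "matching S B G {}" by (simp add: matching_def)
  hence "welfare v S B G \<in> value_of v ` {M. matching S B G M}"
    unfolding welfare_def by (intro Max_in) (auto intro: finite_matchings assms)
  thus ?thesis using that by auto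
qed

lemma matching_mono:
  "matching S' B' G M \<Longrightarrow> S' \<subseteq> S \<Longrightarrow> B' \<subseteq> B \<Longrightarrow> matching S B G M"
  unfolding matching_def by blast

lemma matching_subset: "matching S B G M \<Longrightarrow> N \<subseteq> M \<Longrightarrow> matching S B G N"
  unfolding matching_def by (meson inj_on_subset order_trans)

lemma matching_avoid:
  assumes "matching S B G M" "J \<inter> snd ` M = {}"
  shows "matching (S - J) B G M"
proof -
  have "snd e \<notin> J" if "e \<in> M" for e
    using assms(2) that by blast
  thus ?thesis using assms(1) by (auto simp: matching_def)
qed

lemma matching_uniq_seller: "matching S B G M \<Longrightarrow> (i, j) \<in> M \<Longrightarrow> (i, k) \<in> M \<Longrightarrow> j = k"
  using inj_onD[of fst M "(i, j)" "(i, k)"] by (simp add: matching_def)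

lemma matching_uniq_buyer: "matching S B G M \<Longrightarrow> (i, j) \<in> M \<Longrightarrow> (l, j) \<in> M \<Longrightarrow> i = l"
  using inj_onD[of snd M "(i, j)" "(l, j)"] by (simp add: matching_def)

lemma welfare_mono_sellers:
  assumes "finite S" "finite B" "S' \<subseteq> S"
  shows "welfare v S' B G \<le> welfare v S B G"
proof -
  have "finite S'" using assms finite_subset by auto
  then obtain M where "matching S' B G M" "value_of v M = welfare v S' B G"
    using welfare_attained assms(2) by metis
  thus ?thesis using value_le_welfare[OF assms(1,2)] matching_mono[OF _ assms(3) order_refl] by metis
qed

text \<open>A bipartite multigraph, with edges \<open>X\<close> and endpoint maps \<open>f\<close> and \<open>g\<close>, of maximum degree 2
  is the disjoint union of two matchings.\<close>

lemma degree_two_split: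
  fixes f :: "'e \<Rightarrow> 'a" and g :: "'e \<Rightarrow> 'c"
  assumes "finite X"
    and "\<And>x y z. x \<in> X \<Longrightarrow> y \<in> X \<Longrightarrow> z \<in> X \<Longrightarrow> f x = f y \<Longrightarrow> f y = f z \<Longrightarrow> x = y \<or> y = z \<or> x = z"
    and "\<And>x y z. x \<in> X \<Longrightarrow> y \<in> X \<Longrightarrow> z \<in> X \<Longrightarrow> g x = g y \<Longrightarrow> g y = g z \<Longrightarrow> x = y \<or> y = z \<or> x = z"
  shows "\<exists>c :: 'e \<Rightarrow> bool. \<forall>x\<in>X. \<forall>y\<in>X. x \<noteq> y \<and> (f x = f y \<or> g x = g y) \<longrightarrow> c x \<noteq> c y"
  using assms
proof (induction "card X" arbitrary: X g rule: less_induct)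
  case less
  show ?case
  proof (cases "inj_on f X")
    case True
    define c where "c x \<longleftrightarrow> x = (SOME y. y \<in> X \<and> g y = g x)" for x
    have "c x \<noteq> c y" if "x \<in> X" "y \<in> X" "x \<noteq> y" "g x = g y" for x y
    proof -
      define r where "r = (SOME y. y \<in> X \<and> g y = g x)"
      have r: "r \<in> X \<and> g r = g x" unfolding r_def by (rule someI[of _ x]) (use that in auto)
      have "r = x \<or> r = y" using less.prems(3)[of r x y] r that by auto
      moreover have "c x \<longleftrightarrow> x = r" "c y \<longleftrightarrow> y = r" using that by (simp_all add: c_def r_def)
      ultimately show ?thesis using that by blast
    qed
    thus ?thesis using True by (metis inj_onD)
  next
    case False
    then obtain a b where ab: "a \<in> X" "b \<in> X" "a \<noteq> b" "f a = f b"
      unfolding inj_on_def by blast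
    define X' where "X' = X - {a, b}"
    define g' where "g' z = (if g z = g b then g a else g z)" for z
    have sub: "X' \<subseteq> X" by (auto simp: X'_def)
    have one: "x = y" if "x \<in> X'" "y \<in> X'" "g x = g y" "g x = g a \<or> g x = g b" for x y
      using that less.prems(3)[of x y a] less.prems(3)[of x y b] ab by (auto simp: X'_def)
    have card_X': "card X' < card X"
      using ab less.prems(1) unfolding X'_def by (intro psubset_card_mono) auto
    have finX': "finite X'" using less.prems(1) by (simp add: X'_def)
    have deg_f: "x = y \<or> y = z \<or> x = z"
      if "x \<in> X'" "y \<in> X'" "z \<in> X'" "f x = f y" "f y = f z" for x y z
      using less.prems(2)[of x y z] that sub by auto
    have deg_g': "x = y \<or> y = z \<or> x = z"
      if h: "x \<in> X'" "y \<in> X'" "z \<in> X'" "g' x = g' y" "g' y = g' z" for x y z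
    proof (cases "g' x = g a")
      case True
      hence "g x = g a \<or> g x = g b" "g y = g a \<or> g y = g b" "g z = g a \<or> g z = g b"
        using h by (auto simp: g'_def split: if_splits)
      thus ?thesis using one h by metis
    next
      case False
      hence "g x = g y" "g y = g z" using h by (auto simp: g'_def split: if_splits)
      thus ?thesis using less.prems(3)[of x y z] h sub by auto
    qed
    have "\<exists>c :: 'e \<Rightarrow> bool.
        \<forall>x\<in>X'. \<forall>y\<in>X'. x \<noteq> y \<and> (f x = f y \<or> g' x = g' y) \<longrightarrow> c x \<noteq> c y"
      by (rule less.hyps[OF card_X' finX'];
          ((rule deg_f; assumption) | (rule deg_g'; assumption)))
    then obtain c :: "'e \<Rightarrow> bool" where c_split:
      "\<forall>x\<in>X'. \<forall>y\<in>X'. x \<noteq> y \<and> (f x = f y \<or> g' x = g' y) \<longrightarrow> c x \<noteq> c y" ..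
    have c: "c x \<noteq> c y" if "x \<in> X'" "y \<in> X'" "x \<noteq> y" "f x = f y \<or> g' x = g' y" for x y
      using c_split that by auto
    define cb where "cb \<longleftrightarrow>
      (if \<exists>z\<in>X'. g z = g b then \<not> c (SOME z. z \<in> X' \<and> g z = g b)
       else if \<exists>z\<in>X'. g z = g a then c (SOME z. z \<in> X' \<and> g z = g a) else True)"
    have some: "(SOME z. z \<in> X' \<and> g z = g w) = z" if "z \<in> X'" "g z = g w" "w = a \<or> w = b" for z w
      using that one by (intro some_equality) auto
    have cb1: "cb \<noteq> c z" if "z \<in> X'" "g z = g b" for z
      using that some[of z b] by (auto simp: cb_def)
    have cb2: "cb = c z" if z: "z \<in> X'" "g z = g a" for z
    proof (cases "\<exists>y\<in>X'. g y = g b")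
      case True
      then obtain y where y: "y \<in> X'" "g y = g b" by blast
      have "y \<noteq> z"
      proof
        assume "y = z"
        thus False using less.prems(3)[of z a b] y z ab by (auto simp: X'_def)
      qed
      hence "c y \<noteq> c z" using c[of y z] y z by (auto simp: g'_def)
      thus ?thesis using cb1[OF y] by auto
    next
      case False
      thus ?thesis using z some[of z a] by (auto simp: cb_def)
    qed
    define c' where "c' x = (if x = b then cb else if x = a then \<not> cb else c x)" for x
    have fab: "f x \<noteq> f a" "f x \<noteq> f b" if "x \<in> X'" for x
      using less.prems(2)[of x a b] that ab by (auto simp: X'_def)
    have "c' x \<noteq> c' y"
      if "x \<in> X" "y \<in> X" "x \<noteq> y" "f x = f y \<or> g x = g y" for x y
    proof -
      have gg: "g x = g y \<Longrightarrow> g' x = g' y" by (simp add: g'_def)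
      have cases: "x = a \<or> x = b \<or> x \<in> X'" "y = a \<or> y = b \<or> y \<in> X'"
        using that by (auto simp: X'_def)
      have na: "a \<notin> X'" "b \<notin> X'" by (auto simp: X'_def)
      show ?thesis
        using cases
      proof (elim disjE)
        assume xy: "x \<in> X'" "y \<in> X'"
        hence "c x \<noteq> c y" using c that gg by blast
        thus ?thesis using xy na by (auto simp: c'_def)
      next
        assume xy: "x = a" "y \<in> X'"
        hence "g y = g a" using that fab by metis
        thus ?thesis using xy na ab cb2[of y] by (auto simp: c'_def)
      next
        assume xy: "x = b" "y \<in> X'"
        hence "g y = g b" using that fab by metis
        thus ?thesis using xy na ab cb1[of y] by (auto simp: c'_def)
      next
        assume xy: "x \<in> X'" "y = a"
        hence "g x = g a" using that fab by metis
        thus ?thesis using xy na ab cb2[of x] by (auto simp: c'_def)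
      next
        assume xy: "x \<in> X'" "y = b"
        hence "g x = g b" using that fab by metis
        thus ?thesis using xy na ab cb1[of x] by (auto simp: c'_def)
      qed (use that ab in \<open>auto simp: c'_def\<close>)
    qed
    thus ?thesis by blast
  qed
qed

text \<open>The exchange argument: the edges of a matching \<open>M\<close> and of \<open>C\<close>, counted with multiplicity,
  are redistributed over two matchings, one of which avoids a seller not touched by \<open>C\<close>
  (for \<open>J = {}\<close>, nothing is avoided).\<close>

lemma exchange:
  fixes M C :: "('b \<times> 's) set"
  assumes fin: "finite S" "finite B"
    and M: "matching S B G M" and C: "C \<subseteq> G \<inter> (B \<times> S)" "inj_on fst C"
    and two: "\<And>x y z. x \<in> C \<Longrightarrow> y \<in> C \<Longrightarrow> z \<in> C \<Longrightarrow> snd x = snd y \<Longrightarrow> snd y = snd z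
                \<Longrightarrow> x = y \<or> y = z \<or> x = z"
    and free: "\<And>x y z. x \<in> C \<Longrightarrow> y \<in> C \<Longrightarrow> x \<noteq> y \<Longrightarrow> snd x = snd y \<Longrightarrow> snd x \<notin> snd ` M"
    and J: "J \<subseteq> {j}" "J \<inter> snd ` C = {}"
  shows "value_of v M + value_of v C \<le> welfare v (S - J) B G + welfare v S B G"
proof -
  have finM: "finite M" using matching_finite[OF fin M] .
  have finC: "finite C" using C(1) fin by (meson Int_lower2 finite_SigmaI finite_subset)
  define X where "X = M \<times> {True} \<union> C \<times> {False}"
  have finX: "finite X" using finM finC by (simp add: X_def)
  have inM: "inj_on fst M" "inj_on snd M" and subM: "M \<subseteq> G \<inter> (B \<times> S)"
    using M by (auto simp: matching_def)
  have 1: "x = y \<or> y = z \<or> x = z"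
    if "x \<in> X" "y \<in> X" "z \<in> X" "fst (fst x) = fst (fst y)" "fst (fst y) = fst (fst z)" for x y z
  proof -
    have "p = q" if "p \<in> M" "q \<in> M" "fst p = fst q" for p q
      using inM(1) that by (auto dest: inj_onD)
    moreover have "p = q" if "p \<in> C" "q \<in> C" "fst p = fst q" for p q
      using C(2) that by (auto dest: inj_onD)
    moreover obtain x1 x2 y1 y2 z1 z2 where e: "x = (x1, x2)" "y = (y1, y2)" "z = (z1, z2)"
      by (metis surj_pair)
    ultimately show ?thesis using that unfolding X_def e
      by (cases x2; cases y2; cases z2; simp)
  qed
  have 2: "x = y \<or> y = z \<or> x = z"
    if "x \<in> X" "y \<in> X" "z \<in> X" "snd (fst x) = snd (fst y)" "snd (fst y) = snd (fst z)" for x y z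
  proof -
    have I: "\<And>p q. p \<in> M \<Longrightarrow> q \<in> M \<Longrightarrow> snd p = snd q \<Longrightarrow> p = q" using inM(2) by (auto dest: inj_onD)
    have F: "\<And>p q r. p \<in> C \<Longrightarrow> q \<in> C \<Longrightarrow> r \<in> M \<Longrightarrow> snd p = snd q \<Longrightarrow> snd r = snd p \<Longrightarrow> p = q"
      using free by (metis imageI)
    obtain x1 x2 y1 y2 z1 z2 where e: "x = (x1, x2)" "y = (y1, y2)" "z = (z1, z2)"
      by (metis surj_pair)
    have s: "snd x1 = snd y1" "snd y1 = snd z1" "snd x1 = snd z1" "snd z1 = snd x1" "snd y1 = snd x1"
      using that e by auto
    note facts = I[OF _ _ s(1)] I[OF _ _ s(2)] I[OF _ _ s(3)]
      F[OF _ _ _ s(1) s(4)] F[OF _ _ _ s(2) s(1)] F[OF _ _ _ s(3) s(5)] two[OF _ _ _ s(1,2)]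
    have "x1 \<in> M \<and> x2 \<or> x1 \<in> C \<and> \<not> x2" "y1 \<in> M \<and> y2 \<or> y1 \<in> C \<and> \<not> y2"
        "z1 \<in> M \<and> z2 \<or> z1 \<in> C \<and> \<not> z2"
      using that(1-3) unfolding X_def e by auto
    with facts show ?thesis unfolding e prod.inject by (smt (verit))
  qed
  have "\<exists>c :: ('b \<times> 's) \<times> bool \<Rightarrow> bool. \<forall>x\<in>X. \<forall>y\<in>X. x \<noteq> y \<and>
      (fst (fst x) = fst (fst y) \<or> snd (fst x) = snd (fst y)) \<longrightarrow> c x \<noteq> c y"
    by (rule degree_two_split[OF finX]; ((rule 1; assumption) | (rule 2; assumption)))
  then obtain c :: "('b \<times> 's) \<times> bool \<Rightarrow> bool" where c_split: "\<forall>x\<in>X. \<forall>y\<in>X. x \<noteq> y \<and>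
      (fst (fst x) = fst (fst y) \<or> snd (fst x) = snd (fst y)) \<longrightarrow> c x \<noteq> c y" ..
  have c: "x = y" if "x \<in> X" "y \<in> X" "c x = c y"
      "fst (fst x) = fst (fst y) \<or> snd (fst x) = snd (fst y)" for x y
    using c_split that by blast
  define N where "N b = {x \<in> X. c x = b}" for b
  have injN: "inj_on fst (N b)" for b
    by (rule inj_onI, rule c) (auto simp: N_def)
  have matN: "matching S B G (fst ` N b)" for b
    unfolding matching_def
  proof (intro conjI)
    show "fst ` N b \<subseteq> G \<inter> (B \<times> S)" using subM C(1) by (auto simp: N_def X_def)
    show "inj_on fst (fst ` N b)" "inj_on snd (fst ` N b)"
      by (auto simp: N_def intro!: inj_onI dest: c)
  qed
  have vN: "value_of v (fst ` N b) = (\<Sum>x\<in>N b. case fst x of (i, j) \<Rightarrow> v i j)" for b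
    unfolding value_of_def by (subst sum.reindex[OF injN]) simp
  have "value_of v (fst ` N True) + value_of v (fst ` N False)
      = (\<Sum>x\<in>N True \<union> N False. case fst x of (i, j) \<Rightarrow> v i j)"
    unfolding vN by (rule sum.union_disjoint[symmetric]) (use finX in \<open>auto simp: N_def\<close>)
  also have "N True \<union> N False = X" by (auto simp: N_def)
  also have "(\<Sum>x\<in>X. case fst x of (i, j) \<Rightarrow> v i j)
      = (\<Sum>x\<in>M \<times> {True}. case fst x of (i, j) \<Rightarrow> v i j)
        + (\<Sum>x\<in>C \<times> {False}. case fst x of (i, j) \<Rightarrow> v i j)"
    unfolding X_def by (rule sum.union_disjoint) (use finM finC in auto)
  also have "\<dots> = value_of v M + value_of v C"
    unfolding value_of_def by (simp add: sum.cartesian_product')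
  finally have tot: "value_of v (fst ` N True) + value_of v (fst ` N False)
      = value_of v M + value_of v C" .
  have "\<exists>b. J \<inter> snd ` fst ` N b = {}"
  proof (rule ccontr)
    assume "\<not> ?thesis"
    hence jJ: "j \<in> J" "j \<in> snd ` fst ` N True" "j \<in> snd ` fst ` N False" using J(1) by blast+
    then obtain x y where xy: "x \<in> N True" "y \<in> N False" "snd (fst x) = j" "snd (fst y) = j"
      by (elim imageE) simp
    have "(a, j) \<notin> C" for a using jJ(1) J(2) by force
    hence "x \<in> M \<times> {True}" "y \<in> M \<times> {True}" using xy by (auto simp: N_def X_def)
    hence "x = y" using xy inM(2) by (auto dest: inj_onD)
    thus False using xy by (auto simp: N_def)
  qed
  then obtain b where b: "J \<inter> snd ` fst ` N b = {}" ..
  have "matching (S - J) B G (fst ` N b)"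
    using matching_avoid[OF matN b] .
  hence "value_of v (fst ` N b) \<le> welfare v (S - J) B G"
    using fin by (intro value_le_welfare) auto
  moreover have "value_of v (fst ` N (\<not> b)) \<le> welfare v S B G"
    using value_le_welfare[OF fin matN] .
  ultimately show ?thesis using tot by (cases b) auto
qed

lemma buyer_utility_matched:
  assumes "matching S B G M" "(i, j) \<in> M"
  shows "buyer_utility v M p i = v i j - p j"
proof -
  have "{j. (i, j) \<in> M} = {j}" using matching_uniq_seller[OF assms(1)] assms(2) by auto
  thus ?thesis by (simp add: buyer_utility_def)
qed

lemma buyer_utility_unmatched:
  "i \<notin> fst ` M \<Longrightarrow> buyer_utility v M p i = 0"
proof -
  assume "i \<notin> fst ` M"
  hence "{j. (i, j) \<in> M} = {}" by force
  thus ?thesis by (simp add: buyer_utility_def)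
qed

lemma competitive_equilibrium_value:
  assumes fin: "finite S" "finite B" and ce: "competitive_equilibrium v S B G M p"
  shows "value_of v M = (\<Sum>i\<in>B. buyer_utility v M p i) + (\<Sum>j\<in>S. p j)"
proof -
  have M: "matching S B G M" using ce by (simp add: competitive_equilibrium_def)
  hence inj: "inj_on fst M" "inj_on snd M" and sub: "fst ` M \<subseteq> B" "snd ` M \<subseteq> S"
    by (auto simp: matching_def)
  have "(\<Sum>i\<in>B. buyer_utility v M p i) = (\<Sum>i\<in>fst ` M. buyer_utility v M p i)"
    by (rule sum.mono_neutral_right) (use fin sub buyer_utility_unmatched in auto)
  also have "\<dots> = (\<Sum>(i, j)\<in>M. v i j - p j)"
    by (subst sum.reindex[OF inj(1)])
      (auto intro!: sum.cong simp: buyer_utility_matched[OF M])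
  finally have 1: "(\<Sum>i\<in>B. buyer_utility v M p i) = (\<Sum>(i, j)\<in>M. v i j - p j)" .
  have "(\<Sum>j\<in>S. p j) = (\<Sum>j\<in>snd ` M. p j)"
    by (rule sum.mono_neutral_right)
      (use fin sub ce in \<open>auto simp: competitive_equilibrium_def\<close>)
  also have "\<dots> = (\<Sum>(i, j)\<in>M. p j)"
    by (subst sum.reindex[OF inj(2)]) (auto intro!: sum.cong)
  finally show ?thesis
    by (simp add: 1 value_of_def sum.distrib[symmetric] case_prod_unfold)
qed

lemma competitive_price_le:
  assumes fin: "finite S" "finite B" and j: "j \<in> S" and p: "competitive_prices v S B G p"
  shows "p j \<le> welfare v S B G - welfare v (S - {j}) B G"
proof -
  obtain M where ce: "competitive_equilibrium v S B G M p"
    using p by (auto simp: competitive_prices_def)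
  define u where "u = buyer_utility v M p"
  have M: "matching S B G M" and p0: "\<And>j. j \<in> S \<Longrightarrow> 0 \<le> p j"
    and u0: "\<And>i. i \<in> B \<Longrightarrow> 0 \<le> u i"
    and up: "\<And>i j. i \<in> B \<Longrightarrow> j \<in> S \<Longrightarrow> (i, j) \<in> G \<Longrightarrow> v i j \<le> u i + p j"
    using ce by (auto simp: competitive_equilibrium_def u_def algebra_simps)
  obtain N where N: "matching (S - {j}) B G N" "value_of v N = welfare v (S - {j}) B G"
    using welfare_attained[of "S - {j}" B] fin by blast
  hence inj: "inj_on fst N" "inj_on snd N" and sub: "N \<subseteq> G \<inter> (B \<times> (S - {j}))"
    by (auto simp: matching_def)
  have "value_of v N \<le> (\<Sum>(i, k)\<in>N. u i + p k)"
    unfolding value_of_def by (rule sum_mono) (use sub up in auto)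
  also have "\<dots> = (\<Sum>i\<in>fst ` N. u i) + (\<Sum>k\<in>snd ` N. p k)"
    by (simp add: sum.reindex[OF inj(1)] sum.reindex[OF inj(2)] sum.distrib case_prod_unfold)
  also have "\<dots> \<le> (\<Sum>i\<in>B. u i) + (\<Sum>k\<in>S - {j}. p k)"
    by (intro add_mono sum_mono2) (use fin sub u0 p0 in auto)
  also have "\<dots> = value_of v M - p j"
    using competitive_equilibrium_value[OF fin ce] sum.remove[OF fin(1) j, of p] by (simp add: u_def)
  also have "\<dots> \<le> welfare v S B G - p j" using value_le_welfare[OF fin M] by simp
  finally show ?thesis using N by simp
qed

lemma marginal_prices_competitive:
  assumes fin: "finite S" "finite B"
  shows "competitive_prices v S B G (\<lambda>j. welfare v S B G - welfare v (S - {j}) B G)"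
    (is "competitive_prices _ _ _ _ ?q")
proof -
  obtain M where M: "matching S B G M" and vM: "value_of v M = welfare v S B G"
    using welfare_attained[OF fin] by blast
  have finM: "finite M" using matching_finite[OF fin M] .
  have sub: "M \<subseteq> G \<inter> (B \<times> S)" and inj: "inj_on fst M" "inj_on snd M"
    using M by (auto simp: matching_def)
  have value_remove: "value_of v (M - {(i, j)}) = welfare v S B G - v i j" if "(i, j) \<in> M" for i j
    using sum.remove[OF finM that, of "\<lambda>(i, j). v i j"] vM by (simp add: value_of_def)
  have q0: "0 \<le> ?q j" for j
    using welfare_mono_sellers[OF fin, of "S - {j}"] by auto
  have unsold: "?q j = 0" if "j \<notin> snd ` M" for j
  proof -
    have "matching (S - {j}) B G M" using M that unfolding matching_def by force
    hence "welfare v S B G \<le> welfare v (S - {j}) B G"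
      using value_le_welfare[of "S - {j}" B G M v] fin vM by simp
    thus ?thesis using q0[of j] by simp
  qed
  have matched: "?q j \<le> v i j" if "(i, j) \<in> M" for i j
  proof -
    have "matching (S - {j}) B G (M - {(i, j)})"
      using matching_subset[OF M, of "M - {(i, j)}"] matching_uniq_buyer[OF M that]
      unfolding matching_def by blast
    thus ?thesis
      using value_le_welfare[of "S - {j}" B G _ v] fin value_remove[OF that] by fastforce
  qed
  have envy: "v i k - ?q k \<le> v i j - ?q j" if ij: "(i, j) \<in> M" and k: "k \<in> S" "(i, k) \<in> G" for i j k
  proof (cases "k = j")
    case False
    obtain N where N: "matching (S - {k}) B G N" "value_of v N = welfare v (S - {k}) B G"
      using welfare_attained[of "S - {k}" B] fin by blast
    have kN: "k \<notin> snd ` N" using N(1) by (auto simp: matching_def)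
    have NS: "matching S B G N" using matching_mono[OF N(1)] by auto
    let ?C = "insert (i, k) (M - {(i, j)})"
    have new: "(i, k) \<notin> M" using matching_uniq_seller[OF M ij] False by auto
    have "value_of v ?C = value_of v (M - {(i, j)}) + v i k"
      using finM new by (simp add: value_of_def)
    hence vC: "value_of v ?C = welfare v S B G - v i j + v i k" using value_remove[OF ij] by simp
    have "value_of v N + value_of v ?C \<le> welfare v (S - {j}) B G + welfare v S B G"
    proof (rule exchange[OF fin NS])
      show "?C \<subseteq> G \<inter> (B \<times> S)" using sub k ij by auto
      show "inj_on fst ?C" using inj(1) matching_uniq_seller[OF M ij] by (auto simp: inj_on_diff)
      show "x = y \<or> y = z \<or> x = z"
        if "x \<in> ?C" "y \<in> ?C" "z \<in> ?C" "snd x = snd y" "snd y = snd z" for x y z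
        using that inj(2) by (auto dest: inj_onD)
      show "snd x \<notin> snd ` N" if "x \<in> ?C" "y \<in> ?C" "x \<noteq> y" "snd x = snd y" for x y
      proof -
        have "snd x = k" using that inj(2) by (auto dest: inj_onD)
        thus ?thesis using kN by simp
      qed
      show "{j} \<inter> snd ` ?C = {}" using matching_uniq_buyer[OF M ij] False by auto
      show "{j} \<subseteq> {j}" ..
    qed
    thus ?thesis using vC N(2) by simp
  qed simp
  have envy0: "v i k - ?q k \<le> 0" if i: "i \<in> B" "i \<notin> fst ` M" and k: "k \<in> S" "(i, k) \<in> G" for i k
  proof -
    obtain N where N: "matching (S - {k}) B G N" "value_of v N = welfare v (S - {k}) B G"
      using welfare_attained[of "S - {k}" B] fin by blast
    have kN: "k \<notin> snd ` N" using N(1) by (auto simp: matching_def)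
    have NS: "matching S B G N" using matching_mono[OF N(1)] by auto
    let ?C = "insert (i, k) M"
    have new: "(i, k) \<notin> M" using i by force
    have vC: "value_of v ?C = welfare v S B G + v i k"
      using finM new vM by (simp add: value_of_def)
    have "value_of v N + value_of v ?C \<le> welfare v (S - {}) B G + welfare v S B G"
    proof (rule exchange[OF fin NS, where j = k])
      show "?C \<subseteq> G \<inter> (B \<times> S)" using sub k i by auto
      show "inj_on fst ?C" using inj(1) i by auto
      show "x = y \<or> y = z \<or> x = z"
        if "x \<in> ?C" "y \<in> ?C" "z \<in> ?C" "snd x = snd y" "snd y = snd z" for x y z
        using that inj(2) by (auto dest: inj_onD)
      show "snd x \<notin> snd ` N" if "x \<in> ?C" "y \<in> ?C" "x \<noteq> y" "snd x = snd y" for x y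
      proof -
        have "snd x = k" using that inj(2) by (auto dest: inj_onD)
        thus ?thesis using kN by simp
      qed
    qed auto
    thus ?thesis using vC N(2) by simp
  qed
  show ?thesis
    unfolding competitive_prices_def competitive_equilibrium_def
  proof (intro exI[of _ M] conjI ballI impI)
    fix i assume i: "i \<in> B"
    show "0 \<le> buyer_utility v M ?q i"
      using buyer_utility_matched[OF M, of i _ v ?q] matched buyer_utility_unmatched[of i M v ?q]
      by (cases "i \<in> fst ` M") fastforce+
    fix k assume k: "k \<in> S" "(i, k) \<in> G"
    show "v i k - ?q k \<le> buyer_utility v M ?q i"
    proof (cases "i \<in> fst ` M")
      case True
      then obtain j where "(i, j) \<in> M" by force
      thus ?thesis using envy k buyer_utility_matched[OF M, of i j v ?q] by metis
    next
      case False
      thus ?thesis using envy0[OF i _ k] buyer_utility_unmatched[of i M v ?q] by simp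
    qed
  qed (use M q0 unsold in auto)
qed

lemma maximum_competitive_prices_iff:
  assumes "finite S" "finite B"
  shows "maximum_competitive_prices v S B G p \<longleftrightarrow> competitive_prices v S B G p \<and>
    (\<forall>j\<in>S. p j = welfare v S B G - welfare v (S - {j}) B G)"
  using marginal_prices_competitive[OF assms, of v G] competitive_price_le[OF assms, of _ v G]
  unfolding maximum_competitive_prices_def by (metis (no_types, lifting) order_antisym)

lemma clearing_price_maximum:
  assumes "finite S" "finite B"
  shows "maximum_competitive_prices v S B G (clearing_price v S B G)"
proof -
  have "maximum_competitive_prices v S B G (\<lambda>j. welfare v S B G - welfare v (S - {j}) B G)"
    using marginal_prices_competitive[OF assms] maximum_competitive_prices_iff[OF assms] by blast
  thus ?thesis unfolding clearing_price_def by (rule someI[of "maximum_competitive_prices v S B G"])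
qed

lemma clearing_price_eq:
  assumes "finite S" "finite B" "j \<in> S"
  shows "clearing_price v S B G j = welfare v S B G - welfare v (S - {j}) B G"
  using clearing_price_maximum[OF assms(1,2)] maximum_competitive_prices_iff[OF assms(1,2)] assms(3)
  by blast

end

theory Submission
  imports Defs
begin

text \<open>Write \<open>p\<^sub>j\<close> and \<open>d\<^sub>i\<close> for the marginal contributions of seller \<open>j\<close> and buyer \<open>i\<close> to the welfare
  \<open>W\<close> of the graph \<open>G(P)\<close>; each family sums to at most \<open>W\<close>. If \<open>j\<close> joins the platform, she can
  trade with any buyer \<open>i\<close>, which gives her at least \<open>v i j\<close> minus the marginal contribution of \<open>i\<close>
  in the market without \<open>j\<close>. Buyers and sellers are complements, so the latter is at most \<open>d\<^sub>i\<close>, and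
  the equilibrium condition yields \<open>v i j \<le> p\<^sub>j / (1 - \<alpha>) + d\<^sub>i\<close>. Summing over an optimal
  matching bounds the optimal welfare by \<open>(1 / (1 - \<alpha>) + 1) W\<close>.\<close>

lemma welfare_le:
  assumes "finite S'" "finite B'" "finite S" "finite B"
    and "\<And>M. matching S' B' G' M \<Longrightarrow> matching S B G M"
  shows "welfare v S' B' G' \<le> welfare v S B G"
  using welfare_attained[OF assms(1,2), of G' v] assms(5) value_le_welfare[OF assms(3,4)] by metis

text \<open>Overlay an optimal matching without \<open>j\<close> and one without \<open>i\<close>.
  Recolouring the edges gives two matchings of the same total value, one of which misses both
  \<open>i\<close> and \<open>j\<close>.\<close>

lemma welfare_complements:
  assumes fin: "finite S" "finite B" and i: "i \<in> B" and j: "j \<in> S"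
  shows "welfare v (S - {j}) B G + welfare v S (B - {i}) G
    \<le> welfare v S B G + welfare v (S - {j}) (B - {i}) G"
proof -
  obtain M where M: "matching (S - {j}) B G M" "value_of v M = welfare v (S - {j}) B G"
    using welfare_attained[of "S - {j}" B] fin by blast
  obtain C where C: "matching S (B - {i}) G C" "value_of v C = welfare v S (B - {i}) G"
    using welfare_attained[of S "B - {i}"] fin by blast
  have finM: "finite M" and finC: "finite C"
    using M(1) C(1) fin matching_finite[of "S - {j}" B] matching_finite[of S "B - {i}"] by auto
  have subM: "M \<subseteq> G \<inter> (B \<times> (S - {j}))" and injM: "inj_on fst M" "inj_on snd M"
    using M(1) by (auto simp: matching_def)
  have subC: "C \<subseteq> G \<inter> ((B - {i}) \<times> S)" and injC: "inj_on fst C" "inj_on snd C"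
    using C(1) by (auto simp: matching_def)
  \<comment> \<open>The extra edge \<open>(i, j)\<close> keeps all degrees at most 2, as \<open>C\<close> misses \<open>i\<close> and \<open>M\<close> misses \<open>j\<close>; its
    colour class, after deleting it, misses both \<open>i\<close> and \<open>j\<close>.\<close>
  define e where "e = ((i, j), 2 :: nat)"
  \<comment> \<open>The tags keep apart the two copies of an edge common to \<open>M\<close> and
    \<open>C\<close>.\<close>
  define Y where "Y = M \<times> {0 :: nat} \<union> C \<times> {1}"
  define X where "X = insert e Y"
  have finX: "finite X" and eY: "e \<notin> Y" using finM finC by (auto simp: X_def Y_def e_def)
  have tags: "x \<in> M \<times> {0} \<or> x \<in> C \<times> {1} \<or> x = e" if "x \<in> X" for x
    using that by (auto simp: X_def Y_def)
  have deg_fst: "x = y \<or> y = z \<or> x = z"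
    if "x \<in> X" "y \<in> X" "z \<in> X" "fst (fst x) = fst (fst y)" "fst (fst y) = fst (fst z)" for x y z
  proof -
    have same: "x = y" if "x \<in> X" "y \<in> X" "snd x = snd y" "fst (fst x) = fst (fst y)" for x y
      using tags[OF that(1)] tags[OF that(2)] that(3,4) injM(1) injC(1)
      by (elim disjE) (auto simp: e_def dest: inj_onD)
    \<comment> \<open>By \<open>same\<close>, distinct edges at a buyer carry distinct tags. Tag 1
      is missing at \<open>i\<close>, and tag 2 occurs only there, so each buyer sees at most two
      tags.\<close>
    have "snd x \<noteq> 1" if "x \<in> X" "fst (fst x) = i" for x
      using tags[OF that(1)] that(2) subC by (cases x) (auto simp: e_def)
    moreover have "snd x \<in> {0, 1, 2}" "snd x = 2 \<Longrightarrow> fst (fst x) = i" if "x \<in> X" for x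
      using tags[OF that] by (auto simp: e_def)
    ultimately show ?thesis using same that by (smt (verit) insertE singletonD)
  qed
  have deg_snd: "x = y \<or> y = z \<or> x = z"
    if "x \<in> X" "y \<in> X" "z \<in> X" "snd (fst x) = snd (fst y)" "snd (fst y) = snd (fst z)" for x y z
  proof -
    have same: "x = y" if "x \<in> X" "y \<in> X" "snd x = snd y" "snd (fst x) = snd (fst y)" for x y
      using tags[OF that(1)] tags[OF that(2)] that(3,4) injM(2) injC(2)
      by (elim disjE) (auto simp: e_def dest: inj_onD)
    \<comment> \<open>For sellers it is tag 0 that is missing at \<open>j\<close>, the only seller
      with tag 2.\<close>
    have "snd x \<noteq> 0" if "x \<in> X" "snd (fst x) = j" for x
      using tags[OF that(1)] that(2) subM by (cases x) (auto simp: e_def)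
    moreover have "snd x \<in> {0, 1, 2}" "snd x = 2 \<Longrightarrow> snd (fst x) = j" if "x \<in> X" for x
      using tags[OF that] by (auto simp: e_def)
    ultimately show ?thesis using same that by (smt (verit) insertE singletonD)
  qed
  have "\<exists>c :: ('b \<times> 'a) \<times> nat \<Rightarrow> bool. \<forall>x\<in>X. \<forall>y\<in>X. x \<noteq> y \<and>
      (fst (fst x) = fst (fst y) \<or> snd (fst x) = snd (fst y)) \<longrightarrow> c x \<noteq> c y"
    by (rule degree_two_split[OF finX]; ((rule deg_fst; assumption) | (rule deg_snd; assumption)))
  then obtain c :: "('b \<times> 'a) \<times> nat \<Rightarrow> bool" where c_split: "\<forall>x\<in>X. \<forall>y\<in>X. x \<noteq> y \<and>
      (fst (fst x) = fst (fst y) \<or> snd (fst x) = snd (fst y)) \<longrightarrow> c x \<noteq> c y" ..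
  have c: "x = y" if "x \<in> X" "y \<in> X" "c x = c y"
      "fst (fst x) = fst (fst y) \<or> snd (fst x) = snd (fst y)" for x y
    using c_split that by blast
  define N where "N b = {x \<in> Y. c x = b}" for b
  have N_X: "x \<in> X" "c x = b" if "x \<in> N b" for x b
    using that by (auto simp: N_def X_def)
  have N_inj: "x = y"
    if "x \<in> N b" "y \<in> N b" "fst (fst x) = fst (fst y) \<or> snd (fst x) = snd (fst y)" for x y b
    using c[of x y] N_X[OF that(1)] N_X[OF that(2)] that(3) by simp
  have injN: "inj_on fst (N b)" for b
    by (rule inj_onI, rule N_inj) auto
  have matN: "matching S B G (fst ` N b)" for b
    unfolding matching_def
  proof (intro conjI)
    show "fst ` N b \<subseteq> G \<inter> (B \<times> S)" using subM subC by (auto simp: N_def Y_def)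
    show "inj_on fst (fst ` N b)" "inj_on snd (fst ` N b)"
      by (intro inj_onI; elim imageE; simp only:; drule (1) N_inj; simp)+
  qed
  have avoid: "fst (fst x) \<noteq> i \<and> snd (fst x) \<noteq> j" if "x \<in> N (c e)" for x
    using c[of x e] N_X[OF that] that eY by (auto simp: X_def N_def e_def)
  have restrict: "matching (S - {j}) (B - {i}) G K"
    if "matching S B G K" "K \<subseteq> (- {i}) \<times> (- {j})" for K
    using that by (auto simp: matching_def)
  have "fst ` N (c e) \<subseteq> (- {i}) \<times> (- {j})"
    by (rule image_subsetI) (simp add: mem_Times_iff avoid)
  hence "matching (S - {j}) (B - {i}) G (fst ` N (c e))"
    using restrict[OF matN] by blast
  hence "value_of v (fst ` N (c e)) \<le> welfare v (S - {j}) (B - {i}) G"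
    using fin by (intro value_le_welfare) auto
  moreover have "value_of v (fst ` N (\<not> c e)) \<le> welfare v S B G"
    using value_le_welfare[OF fin matN] .
  moreover have "value_of v (fst ` N (c e)) + value_of v (fst ` N (\<not> c e))
      = value_of v M + value_of v C"
  proof -
    let ?h = "\<lambda>x :: ('b \<times> 'a) \<times> nat. case fst x of (i, j) \<Rightarrow> v i j"
    have vN: "value_of v (fst ` N b) = sum ?h (N b)" for b
      unfolding value_of_def by (subst sum.reindex[OF injN]) simp
    have "sum ?h (N (c e)) + sum ?h (N (\<not> c e)) = sum ?h (N (c e) \<union> N (\<not> c e))"
      by (rule sum.union_disjoint[symmetric]) (use finM finC in \<open>auto simp: N_def Y_def\<close>)
    also have "N (c e) \<union> N (\<not> c e) = Y" by (auto simp: N_def)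
    also have "sum ?h Y = sum ?h (M \<times> {0}) + sum ?h (C \<times> {1})"
      unfolding Y_def by (rule sum.union_disjoint) (use finM finC in auto)
    also have "\<dots> = value_of v M + value_of v C"
      unfolding value_of_def by (simp add: sum.cartesian_product')
    finally show ?thesis by (simp add: vN)
  qed
  ultimately show ?thesis using M(2) C(2) by simp
qed

text \<open>Deleting the edges at \<open>i\<close> from an optimal matching leaves a matching
  without \<open>i\<close>, so the loss is at most the value of these edges. Grouped by buyer, they
  make up the whole matching.\<close>

lemma sum_buyer_marginals_le:
  assumes fin: "finite S" "finite B"
  shows "(\<Sum>i\<in>B. welfare v S B G - welfare v S (B - {i}) G) \<le> welfare v S B G"
proof -
  obtain M where M: "matching S B G M" "value_of v M = welfare v S B G"
    using welfare_attained[OF fin] by blast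
  have finM: "finite M" using matching_finite[OF fin M(1)] .
  let ?h = "\<lambda>(i, j). v i j"
  have "welfare v S B G - welfare v S (B - {i}) G \<le> sum ?h {x \<in> M. fst x = i}" for i
  proof -
    have "matching S (B - {i}) G (M - {x \<in> M. fst x = i})"
      using matching_subset[OF M(1), of "M - {x \<in> M. fst x = i}"] by (auto simp: matching_def)
    hence "value_of v (M - {x \<in> M. fst x = i}) \<le> welfare v S (B - {i}) G"
      using fin by (intro value_le_welfare) auto
    moreover have "value_of v (M - {x \<in> M. fst x = i}) = value_of v M - sum ?h {x \<in> M. fst x = i}"
      unfolding value_of_def by (rule sum_diff) (use finM in auto)
    ultimately show ?thesis using M(2) by simp
  qed
  hence "(\<Sum>i\<in>B. welfare v S B G - welfare v S (B - {i}) G)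
      \<le> (\<Sum>i\<in>B. sum ?h {x \<in> M. fst x = i})"
    by (rule sum_mono)
  also have "\<dots> = sum ?h M"
    by (rule sum.group[OF finM fin(2)]) (use M(1) in \<open>auto simp: matching_def\<close>)
  finally show ?thesis using M(2) by (simp add: value_of_def)
qed

text \<open>The value of an equilibrium matching splits into prices and buyer utilities, and the
  latter are nonnegative.\<close>

lemma sum_competitive_prices_le:
  assumes fin: "finite S" "finite B" and p: "competitive_prices v S B G p"
  shows "(\<Sum>j\<in>S. p j) \<le> welfare v S B G"
proof -
  obtain M where ce: "competitive_equilibrium v S B G M p"
    using p by (auto simp: competitive_prices_def)
  have "0 \<le> (\<Sum>i\<in>B. buyer_utility v M p i)"
    by (rule sum_nonneg) (use ce in \<open>auto simp: competitive_equilibrium_def\<close>)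
  moreover have "value_of v M \<le> welfare v S B G"
    using ce by (intro value_le_welfare[OF fin]) (simp add: competitive_equilibrium_def)
  ultimately show ?thesis using competitive_equilibrium_value[OF fin ce] by simp
qed

lemma welfare_insert_pair:
  assumes fin: "finite S" "finite B" and ij: "i \<in> B" "j \<in> S" "(i, j) \<in> G"
  shows "v i j + welfare v (S - {j}) (B - {i}) G \<le> welfare v S B G"
proof -
  obtain M where M: "matching (S - {j}) (B - {i}) G M"
      "value_of v M = welfare v (S - {j}) (B - {i}) G"
    using welfare_attained[of "S - {j}" "B - {i}"] fin by blast
  have finM: "finite M" using matching_finite[OF _ _ M(1)] fin by simp
  have "(i, j) \<notin> M" using M(1) by (auto simp: matching_def)
  hence "value_of v (insert (i, j) M) = v i j + value_of v M"
    using finM by (simp add: value_of_def)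
  moreover have "matching S B G (insert (i, j) M)"
    unfolding matching_def
  proof (intro conjI)
    have sub: "M \<subseteq> G \<inter> ((B - {i}) \<times> (S - {j}))" and inj: "inj_on fst M" "inj_on snd M"
      using M(1) by (auto simp: matching_def)
    have "i \<notin> fst ` M" "j \<notin> snd ` M" using sub by auto
    thus "inj_on fst (insert (i, j) M)" "inj_on snd (insert (i, j) M)" using inj by auto
    show "insert (i, j) M \<subseteq> G \<inter> (B \<times> S)" using sub ij by auto
  qed
  ultimately show ?thesis using value_le_welfare[OF fin] M(2) by metis
qed

text \<open>Once connected, \<open>j\<close> can serve \<open>i\<close>, while the other agents are
  matched optimally among themselves. Complementarity bounds what they lose by the absence of
  \<open>i\<close>.\<close>

lemma joining_price_ge:
  assumes fin: "finite S" "finite B" and i: "i \<in> B" and j: "j \<in> S"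
  shows "v i j - (welfare v S B (join_platform B G P) - welfare v S (B - {i}) (join_platform B G P))
    \<le> clearing_price v S B (join_platform B G (P \<union> {j})) j"
proof -
  let ?G = "join_platform B G P" and ?G' = "join_platform B G (P \<union> {j})"
  \<comment> \<open>Joining only adds edges at \<open>j\<close>, so both graphs have the same
    matchings once \<open>j\<close> is removed.\<close>
  have "welfare v (S - {j}) B ?G' \<le> welfare v (S - {j}) B ?G"
    by (rule welfare_le) (use fin in \<open>auto simp: matching_def join_platform_def\<close>)
  moreover have "welfare v (S - {j}) (B - {i}) ?G \<le> welfare v (S - {j}) (B - {i}) ?G'"
    by (rule welfare_le) (use fin in \<open>auto simp: matching_def join_platform_def\<close>)
  moreover have "v i j + welfare v (S - {j}) (B - {i}) ?G' \<le> welfare v S B ?G'"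
    by (rule welfare_insert_pair) (use assms in \<open>auto simp: join_platform_def\<close>)
  ultimately show ?thesis
    using welfare_complements[OF fin i j, of v ?G] clearing_price_eq[OF fin j, of v ?G']
    by simp
qed

theorem theorem5p1:
  fixes S P :: "'s set" and B :: "'b set" and v :: "'b \<Rightarrow> 's \<Rightarrow> real"
    and G :: "('b \<times> 's) set" and \<alpha> :: real
  assumes "market S B v G"
    and "0 \<le> \<alpha>" and "\<alpha> < 1"
    and "P \<subseteq> S"
    and "platform_equilibrium \<alpha> v S B G P"
  shows "optimal_welfare v S B \<le> (2 - \<alpha>) / (1 - \<alpha>) * welfare v S B (join_platform B G P)"
proof -
  have fin: "finite S" "finite B" using assms(1) by (auto simp: market_def)
  let ?G = "join_platform B G P"
  define W where "W = welfare v S B ?G"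
  define p where "p = clearing_price v S B ?G"
  define d where "d i = W - welfare v S (B - {i}) ?G" for i
  have p: "competitive_prices v S B ?G p"
    using clearing_price_maximum[OF fin] by (auto simp: p_def maximum_competitive_prices_def)
  hence p0: "0 \<le> p j" if "j \<in> S" for j
    using that by (auto simp: competitive_prices_def competitive_equilibrium_def)
  have d0: "0 \<le> d i" for i
    using welfare_le[of S "B - {i}" S B ?G ?G v] fin
    by (auto simp: d_def W_def matching_def)
  have join: "clearing_price v S B (join_platform B G (P \<union> {j})) j \<le> p j / (1 - \<alpha>)"
    if j: "j \<in> S" for j
  proof -
    have "(1 - \<alpha>) * clearing_price v S B (join_platform B G (P \<union> {j})) j \<le> p j"
    proof (cases "j \<in> P")
      case True
      \<comment> \<open>For a seller already on the platform the graph is unchanged, and the fee can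
        only lower the nonnegative \<open>p j\<close>.\<close>
      hence "P \<union> {j} = P" by blast
      thus ?thesis using mult_right_mono[of "1 - \<alpha>" 1 "p j"] p0[OF j] assms(2) by (simp add: p_def)
    next
      case False
      \<comment> \<open>Here \<open>j\<close> is off the platform and has no incentive to
        join.\<close>
      thus ?thesis using assms(5) j
        by (auto simp: platform_equilibrium_def seller_utility_def p_def)
    qed
    thus ?thesis using assms(3) by (simp add: field_simps)
  qed
  obtain M where M: "matching S B (B \<times> S) M" "value_of v M = optimal_welfare v S B"
    using welfare_attained[OF fin] unfolding optimal_welfare_def by blast
  hence inj: "inj_on fst M" "inj_on snd M" and sub: "M \<subseteq> B \<times> S" by (auto simp: matching_def)
  \<comment> \<open>In the language of linear programming, \<open>d\<close> and \<open>p\<close>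
    scaled by \<open>1 / (1 - \<alpha>)\<close> act as dual variables covering the edges of
    \<open>M\<close>.\<close>
  have "v i j \<le> d i + p j / (1 - \<alpha>)" if "(i, j) \<in> M" for i j
    using joining_price_ge[OF fin, of i j v G P] join[of j] that sub by (auto simp: d_def W_def)
  hence "value_of v M \<le> (\<Sum>(i, j)\<in>M. d i + p j / (1 - \<alpha>))"
    unfolding value_of_def by (intro sum_mono) auto
  also have "\<dots> = (\<Sum>i\<in>fst ` M. d i) + (\<Sum>j\<in>snd ` M. p j / (1 - \<alpha>))"
    by (simp add: sum.reindex[OF inj(1)] sum.reindex[OF inj(2)] sum.distrib case_prod_unfold)
  \<comment> \<open>Agents unmatched in \<open>M\<close> add only nonnegative terms.\<close>
  also have "\<dots> \<le> (\<Sum>i\<in>B. d i) + (\<Sum>j\<in>S. p j / (1 - \<alpha>))"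
    by (intro add_mono sum_mono2) (use fin sub d0 p0 assms(3) in auto)
  also have "\<dots> \<le> W + W / (1 - \<alpha>)"
    using sum_buyer_marginals_le[OF fin, of v ?G] sum_competitive_prices_le[OF fin p] assms(3)
    by (intro add_mono) (auto simp: d_def W_def sum_divide_distrib[symmetric] divide_right_mono)
  also have "\<dots> = (2 - \<alpha>) / (1 - \<alpha>) * W"
    using assms(3) by (simp add: field_simps)
  finally show ?thesis using M(2) by (simp add: W_def)
qed

end
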